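(* Let $R>r>0$ be real numbers. The quotient space $C_T=[-1,1]^2/\!\sim_{CT}$ (with the quotient topology) and the subspace $T\subset\mathbb{R}^3$ (with the subspace topology) are homeomorphic.
   Context: On the square $[-1,1]^2$ (fundamental polygon of the 2-torus) the equivalence relation $\sim_{CT}$ is the one identifying opposite sides with the same orientation: $(u,v)\sim_{CT}(u',v')$ if and only if [$u'=u$ or ($u\in\{-1,1\}$ and $u'=-u$)] and [$v'=v$ or ($v\in\{-1,1\}$ and $v'=-v$)]. For $R>r>0$, the map $t:[-1,1]^2\to\mathbb{R}^3$ is defined by $$t(u,v)=\Big(\big(R+r\cos(v\pi)\big)\cos(u\pi),\ \big(R+r\cos(v\pi)\big)\sin(u\pi),\ r\sin(v\pi)\Big),$$ and $T=t([-1,1]^2)$ is its image. *)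

theory Defs
  imports "HOL-Analysis.Analysis"
begin

text \<open>The quotient topology on the set of classes \<open>topspace X // r\<close>: a set of classes is open iff
  its preimage under the canonical projection \<open>x \<mapsto> r `` {x}\<close> is open in \<open>X\<close>.\<close>

definition quotient_topology :: "'a topology \<Rightarrow> ('a \<times> 'a) set \<Rightarrow> 'a set topology" where
  "quotient_topology X r =
     topology (\<lambda>U. U \<subseteq> topspace X // r \<and> openin X {x \<in> topspace X. r `` {x} \<in> U})"

lemma openin_quotient_topology:
  "openin (quotient_topology X r) U \<longleftrightarrow>
     U \<subseteq> topspace X // r \<and> openin X {x \<in> topspace X. r `` {x} \<in> U}"
proof -
  have "istopology (\<lambda>U. U \<subseteq> topspace X // r \<and> openin X {x \<in> topspace X. r `` {x} \<in> U})"
    unfolding istopology_def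
  proof (intro conjI allI impI)
    fix S T
    assume S: "S \<subseteq> topspace X // r \<and> openin X {x \<in> topspace X. r `` {x} \<in> S}"
      and T: "T \<subseteq> topspace X // r \<and> openin X {x \<in> topspace X. r `` {x} \<in> T}"
    show "S \<inter> T \<subseteq> topspace X // r" using S by blast
    have "{x \<in> topspace X. r `` {x} \<in> S \<inter> T} =
        {x \<in> topspace X. r `` {x} \<in> S} \<inter> {x \<in> topspace X. r `` {x} \<in> T}" by blast
    then show "openin X {x \<in> topspace X. r `` {x} \<in> S \<inter> T}" using S T by auto
  next
    fix K
    assume K: "\<forall>S\<in>K. S \<subseteq> topspace X // r \<and> openin X {x \<in> topspace X. r `` {x} \<in> S}"
    show "\<Union>K \<subseteq> topspace X // r" using K by blast
    have "{x \<in> topspace X. r `` {x} \<in> \<Union>K} =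
        (\<Union>S\<in>K. {x \<in> topspace X. r `` {x} \<in> S})" by blast
    then show "openin X {x \<in> topspace X. r `` {x} \<in> \<Union>K}" using K by auto
  qed
  then show ?thesis by (simp add: quotient_topology_def)
qed

lemma topspace_quotient_topology [simp]: "topspace (quotient_topology X r) = topspace X // r"
proof (rule antisym)
  show "topspace (quotient_topology X r) \<subseteq> topspace X // r"
    using openin_quotient_topology[of X r "topspace (quotient_topology X r)"] by auto
  have "{x \<in> topspace X. r `` {x} \<in> topspace X // r} = topspace X"
    by (auto intro: quotientI)
  then have "openin (quotient_topology X r) (topspace X // r)"
    by (simp add: openin_quotient_topology)
  then show "topspace X // r \<subseteq> topspace (quotient_topology X r)"
    by (rule openin_subset)
qed

lemma quotient_map_quotient_topology:
  "quotient_map X (quotient_topology X r) (\<lambda>x. r `` {x})"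
  unfolding quotient_map_def by (auto simp: openin_quotient_topology quotient_def)

definition fundamental_square :: "(real \<times> real) set" where
  "fundamental_square = {-1..1} \<times> {-1..1}"

definition torus_rel :: "((real \<times> real) \<times> (real \<times> real)) set" where
  "torus_rel = {((u, v), (u', v')).
     (u, v) \<in> fundamental_square \<and> (u', v') \<in> fundamental_square \<and>
     (u' = u \<or> (u \<in> {-1, 1} \<and> u' = - u)) \<and>
     (v' = v \<or> (v \<in> {-1, 1} \<and> v' = - v))}"

lemma equiv_torus_rel: "equiv fundamental_square torus_rel"
  by (rule equivI) (auto simp: torus_rel_def refl_on_def sym_def trans_def)

definition torus_quotient :: "(real \<times> real) set topology" where
  "torus_quotient = quotient_topology (top_of_set fundamental_square) torus_rel"

definition torus_map :: "real \<Rightarrow> real \<Rightarrow> real \<times> real \<Rightarrow> real ^ 3" where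
  "torus_map R r = (\<lambda>(u, v). vector
     [(R + r * cos (v * pi)) * cos (u * pi),
      (R + r * cos (v * pi)) * sin (u * pi),
      r * sin (v * pi)])"

definition torus :: "real \<Rightarrow> real \<Rightarrow> (real ^ 3) set" where
  "torus R r = torus_map R r ` fundamental_square"

end

theory Submission
  imports Defs
begin

text \<open>Wrapping the square around the torus glues exactly the points that the relation identifies:
  since \<open>R > r\<close>, the distance \<open>R + r * cos (v * pi)\<close> of a point of the torus from the axis is
  positive, so the point determines this distance, hence the direction \<open>v * pi\<close> on the meridian
  circle, and then, after division by the distance, the direction \<open>u * pi\<close> around the axis
  (\<open>torus_map_eq_iff\<close>). On \<open>[-1, 1]\<close> a direction determines the parameter except that the two
  ends agree (\<open>direction_eq_iff\<close>). So the map descends to a continuous bijection from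
  the quotient onto the torus. The quotient is compact, being an image of the square, and the torus
  is Hausdorff, so this bijection is a homeomorphism (\<open>quotient_topology_homeomorphic_space\<close>).\<close>

text \<open>A continuous map from a compact space onto a Hausdorff space is closed, so the induced
  bijection from the set of fibres is closed as well as continuous.\<close>

lemma quotient_topology_homeomorphic_space:
  assumes X: "compact_space X" and Y: "Hausdorff_space Y"
    and f: "continuous_map X Y f" and surj: "f ` topspace X = topspace Y"
    and r: "equiv (topspace X) r"
    and fibres: "\<And>x y. \<lbrakk>x \<in> topspace X; y \<in> topspace X\<rbrakk> \<Longrightarrow> (x, y) \<in> r \<longleftrightarrow> f x = f y"
  shows "quotient_topology X r homeomorphic_space Y"
proof -
  let ?Q = "quotient_topology X r" and ?p = "\<lambda>x. r `` {x}"
  have p: "quotient_map X ?Q ?p"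
    by (rule quotient_map_quotient_topology)
  have class_eq: "?p x = ?p y \<longleftrightarrow> f x = f y" if "x \<in> topspace X" "y \<in> topspace X" for x y
    using that eq_equiv_class_iff[OF r] fibres by blast
  obtain g where g: "continuous_map ?Q Y g" "g ` topspace ?Q = f ` topspace X"
    and gp: "\<And>x. x \<in> topspace X \<Longrightarrow> g (?p x) = f x"
    using quotient_map_lift_exists[OF p f] class_eq by metis
  have "compact_space ?Q"
    using p X compactin_def image_compactin[of X "topspace X" ?Q ?p]
    by (simp add: compact_space_def quotient_imp_continuous_map
        quotient_imp_surjective_map del: topspace_quotient_topology)
  moreover have "inj_on g (topspace ?Q)"
  proof (rule inj_onI)
    fix a b assume "a \<in> topspace ?Q" "b \<in> topspace ?Q" and ab: "g a = g b"
    then obtain x y where "x \<in> topspace X" "a = ?p x" "y \<in> topspace X" "b = ?p y"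
      by (auto elim!: quotientE)
    then show "a = b"
      using ab gp class_eq by simp
  qed
  ultimately have "homeomorphic_map ?Q Y g"
    using g surj Y by (intro continuous_imp_homeomorphic_map) auto
  then show ?thesis
    using homeomorphic_space by blast
qed

text \<open>Equal directions mean that the parameters differ by a multiple of 2, the length of the
  interval.\<close>

lemma direction_eq_iff:
  fixes a b :: real
  assumes "a \<in> {-1..1}" "b \<in> {-1..1}"
  shows "cos (a * pi) = cos (b * pi) \<and> sin (a * pi) = sin (b * pi)
    \<longleftrightarrow> b = a \<or> a \<in> {-1, 1} \<and> b = - a"
proof
  assume "cos (a * pi) = cos (b * pi) \<and> sin (a * pi) = sin (b * pi)"
  then obtain n :: int where "b * pi = a * pi + 2 * pi * n"
    using sin_cos_eq_iff[of "b * pi" "a * pi"] by auto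
  then have "(b - a - 2 * n) * pi = 0"
    by (simp add: algebra_simps)
  then have n: "b = a + 2 * n"
    by simp
  with assms have "\<bar>real_of_int n\<bar> \<le> 1"
    by auto
  then have "n = -1 \<or> n = 0 \<or> n = 1"
    by linarith
  then show "b = a \<or> a \<in> {-1, 1} \<and> b = - a"
    using n assms by auto
qed auto

lemma torus_map_eq_iff:
  assumes "R > r" "r > 0"
  shows "torus_map R r (u, v) = torus_map R r (u', v') \<longleftrightarrow>
    (cos (u * pi) = cos (u' * pi) \<and> sin (u * pi) = sin (u' * pi)) \<and>
    (cos (v * pi) = cos (v' * pi) \<and> sin (v * pi) = sin (v' * pi))"
    (is "?L \<longleftrightarrow> ?R")
proof
  assume ?L
  define d where "d = (\<lambda>v. R + r * cos (v * pi))"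
  have d_pos: "d w > 0" for w
  proof -
    have "r * cos (w * pi) \<ge> r * (-1)"
      using assms by (intro mult_left_mono) auto
    then show ?thesis
      using assms by (simp add: d_def)
  qed
  have d_norm: "(d w * cos x)\<^sup>2 + (d w * sin x)\<^sup>2 = (d w)\<^sup>2" for w x
    by (simp add: power_mult_distrib flip: distrib_left)
  have eqs: "d v * cos (u * pi) = d v' * cos (u' * pi)"
    "d v * sin (u * pi) = d v' * sin (u' * pi)" "r * sin (v * pi) = r * sin (v' * pi)"
    using \<open>?L\<close> by (simp_all add: torus_map_def vec_eq_iff forall_3 d_def)
  have "(d v)\<^sup>2 = (d v')\<^sup>2"
    using d_norm[of v "u * pi"] d_norm[of v' "u' * pi"] eqs by simp
  then have d_eq: "d v = d v'"
    using d_pos[of v] d_pos[of v'] by (simp add: power2_eq_iff_nonneg)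
  then have "cos (v * pi) = cos (v' * pi)"
    using assms by (simp add: d_def)
  then show ?R
    using eqs d_eq d_pos[of v'] assms by simp
qed (simp add: torus_map_def)

lemma continuous_on_torus_map: "continuous_on S (torus_map R r)"
proof -
  have "continuous_on S (\<lambda>x. torus_map R r x $ i)" for i
    using exhaust_3[of i]
    by (elim disjE; simp add: torus_map_def case_prod_unfold; intro continuous_intros)
  then have "continuous_on S (\<lambda>x. \<chi> i. torus_map R r x $ i)"
    by (rule continuous_on_vec_lambda)
  then show ?thesis
    by simp
qed

theorem mainTheorem2:
  fixes R r :: real
  assumes "R > r" and "r > 0"
  shows "torus_quotient homeomorphic_space top_of_set (torus R r)"
  unfolding torus_quotient_def
proof (rule quotient_topology_homeomorphic_space)
  show "compact_space (top_of_set fundamental_square)"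
    by (simp add: compact_space_subtopology fundamental_square_def compact_Times)
  show "Hausdorff_space (top_of_set (torus R r))"
    by (simp add: Hausdorff_space_subtopology)
  show "continuous_map (top_of_set fundamental_square) (top_of_set (torus R r)) (torus_map R r)"
    by (auto simp: continuous_on_torus_map torus_def)
  show "torus_map R r ` topspace (top_of_set fundamental_square) = topspace (top_of_set (torus R r))"
    by (simp add: torus_def)
  show "equiv (topspace (top_of_set fundamental_square)) torus_rel"
    using equiv_torus_rel by simp
  fix p q
  assume "p \<in> topspace (top_of_set fundamental_square)"
    "q \<in> topspace (top_of_set fundamental_square)"
  moreover obtain u v u' v' where "p = (u, v)" "q = (u', v')"
    by fastforce
  ultimately show "(p, q) \<in> torus_rel \<longleftrightarrow> torus_map R r p = torus_map R r q"
    using direction_eq_iff[of u u'] direction_eq_iff[of v v']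
    by (simp add: torus_map_eq_iff[OF assms] torus_rel_def fundamental_square_def)
qed

end
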